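(* Let $0\le c<1/2$ and let $(p_n)_{n\ge1}$ be a sequence in $[0,1]$ with $p_n=\Omega(n^{-c})$, and for each $n$ let $G_n$ be a random graph drawn from the Erdős–Rényi distribution $G(n,p_n)$. Then for all $\epsilon>0$ and $\delta>0$ there exists $N$ such that for all $n\ge N$, $$P[\mathrm{GAPEB}(G_n)<1+\delta]>1-\epsilon.$$
   Context: $p_n=\Omega(n^{-c})$ means there exist $k>0$ and $n_0$ with $p_n \ge k n^{-c}$ for all $n\ge n_0$. The distribution $G(n,p)$ on graphs with vertex set of size $n$ includes each of the $\binom{n}{2}$ possible edges independently with probability $p$. For an undirected graph $G=(V,E)$ with $|V|=n$, a layout is a bijection $\phi:V\to\{1,\dots,n\}$. For $1\le i\le n$, $\theta(i,\phi,G)$ is the number of edges $uv\in E$ with $\phi(u)\le i<\phi(v)$. Define $\mathrm{EB}(G,\phi)=\theta(\lfloor n/2\rfloor,\phi,G)$, $\mathrm{MINEB}(G)=\min_\phi\mathrm{EB}(G,\phi)$, $\mathrm{MAXEB}(G)=\max_\phi\mathrm{EB}(G,\phi)$ over all layouts $\phi$, and $\mathrm{GAPEB}(G)=\mathrm{MAXEB}(G)/\mathrm{MINEB}(G)$. *)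

theory Defs
  imports "HOL-Probability.Probability" "HOL-Probability.Product_PMF" "HOL-Library.Landau_Symbols"
begin

text \<open>An undirected simple graph is a pair of a vertex set and a set of two-element vertex sets.\<close>

type_synonym 'a graph = "'a set \<times> 'a set set"

definition possible_edges :: "'a set \<Rightarrow> 'a set set" where
  "possible_edges V = {e. e \<subseteq> V \<and> card e = 2}"

text \<open>The vertex set of size \<open>n\<close> is taken to be \<open>{1..n}\<close>; the independent indicators
  \<open>b e\<close> decide which edges are present.\<close>

definition Gnp :: "nat \<Rightarrow> real \<Rightarrow> nat graph pmf" where
  "Gnp n p =
    map_pmf (\<lambda>b. ({1..n}, {e \<in> possible_edges {1..n}. b e}))
      (Pi_pmf (possible_edges {1..n}) False (\<lambda>_. bernoulli_pmf p))"

definition layouts :: "'a graph \<Rightarrow> ('a \<Rightarrow> nat) set" where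
  "layouts G = {\<phi>. bij_betw \<phi> (fst G) {1..card (fst G)}}"

definition theta :: "nat \<Rightarrow> ('a \<Rightarrow> nat) \<Rightarrow> 'a graph \<Rightarrow> nat" where
  "theta i \<phi> G = card {e \<in> snd G. \<exists>u v. e = {u, v} \<and> \<phi> u \<le> i \<and> i < \<phi> v}"

definition EB :: "'a graph \<Rightarrow> ('a \<Rightarrow> nat) \<Rightarrow> nat" where
  "EB G \<phi> = theta (card (fst G) div 2) \<phi> G"

definition MINEB :: "'a graph \<Rightarrow> nat" where
  "MINEB G = Min (EB G ` layouts G)"

definition MAXEB :: "'a graph \<Rightarrow> nat" where
  "MAXEB G = Max (EB G ` layouts G)"

text \<open>\<open>Min\<close> and \<open>Max\<close> above range over a finite nonempty set: layouts are total functions, so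
  there may be infinitely many of them, but they attain only finitely many values.\<close>

lemma finite_EB_layouts:
  assumes "finite (snd G)"
  shows "finite (EB G ` layouts G)"
proof (rule finite_subset)
  show "EB G ` layouts G \<subseteq> {..card (snd G)}"
    using assms by (auto simp: EB_def theta_def intro!: card_mono)
qed simp

lemma EB_layouts_nonempty:
  assumes "finite (fst G)"
  shows "EB G ` layouts G \<noteq> {}"
proof -
  have "\<exists>\<phi>. bij_betw \<phi> (fst G) {1..card (fst G)}"
    using assms by (intro finite_same_card_bij) auto
  then show ?thesis by (auto simp: layouts_def)
qed

text \<open>The quotient is undefined when \<open>MINEB G = 0\<close>. HOL division would then return \<open>0\<close> and
  make every upper bound on the gap true, so the value \<open>\<infinity>\<close> is used instead.\<close>

definition GAPEB :: "'a graph \<Rightarrow> ereal" where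
  "GAPEB G = (if MINEB G = 0 then \<infinity> else ereal (real (MAXEB G) / real (MINEB G)))"

end

theory Submission
  imports Defs "HOL-Real_Asymp.Real_Asymp"
begin

text \<open>A layout enters \<open>EB\<close> only through the bisection \<open>(S, V - S)\<close> formed by its first
  \<open>\<lfloor>n/2\<rfloor>\<close> vertices. The number of random edges crossing a fixed bisection is binomial with mean
  \<open>m p\<close>, where \<open>m = \<lfloor>n/2\<rfloor> \<lceil>n/2\<rceil>\<close>, so by Hoeffding's inequality it leaves the interval between
  \<open>(1 - t) m p\<close> and \<open>(1 + t) m p\<close> with probability at most \<open>2 exp (- 2 m (t p)\<^sup>2)\<close>. For
  \<open>p = \<Omega>(n\<^sup>-\<^sup>c)\<close> with \<open>c < 1/2\<close> the exponent is superlinear in \<open>n\<close>, which beats the union bound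
  over the at most \<open>2\<^sup>n\<close> bisections. If no bisection deviates, then the gap is less than
  \<open>(1 + t) / (1 - t)\<close>, which equals \<open>1 + \<delta>\<close> for \<open>t = \<delta> / (2 + \<delta>)\<close>.\<close>

definition cut_edges :: "'a set \<Rightarrow> 'a set \<Rightarrow> 'a set set" where
  "cut_edges V S = (\<lambda>(u, v). {u, v}) ` (S \<times> (V - S))"

definition bisections :: "'a set \<Rightarrow> 'a set set" where
  "bisections V = {S. S \<subseteq> V \<and> card S = card V div 2}"

definition bisection_cut_size :: "nat \<Rightarrow> nat" where
  "bisection_cut_size n = (n div 2) * (n - n div 2)"

lemma finite_possible_edges: "finite V \<Longrightarrow> finite (possible_edges V)"
  by (simp add: possible_edges_def)

lemma cut_edges_subset_possible_edges: "S \<subseteq> V \<Longrightarrow> cut_edges V S \<subseteq> possible_edges V"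
  by (auto simp: cut_edges_def possible_edges_def card_2_iff)

lemma card_cut_edges: "card (cut_edges V S) = card S * card (V - S)"
proof -
  have "inj_on (\<lambda>(u, v). {u, v}) (S \<times> (V - S))"
    by (auto simp: inj_on_def doubleton_eq_iff)
  then show ?thesis
    by (simp add: cut_edges_def card_image card_cartesian_product)
qed

lemma card_cut_edges_bisection:
  assumes "finite V" "S \<in> bisections V"
  shows "card (cut_edges V S) = bisection_cut_size (card V)"
  using assms
  by (auto simp: bisections_def bisection_cut_size_def card_cut_edges card_Diff_subset finite_subset)

lemma finite_bisections: "finite V \<Longrightarrow> finite (bisections V)"
  by (simp add: bisections_def)

lemma card_bisections_le: "finite V \<Longrightarrow> card (bisections V) \<le> 2 ^ card V"
  by (simp add: bisections_def n_subsets binomial_le_pow2)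

lemma theta_eq_card_cut_edges:
  assumes "E \<subseteq> possible_edges V"
  shows "theta i \<phi> (V, E) = card (cut_edges V {v \<in> V. \<phi> v \<le> i} \<inter> E)"
proof -
  have "{e \<in> E. \<exists>u v. e = {u, v} \<and> \<phi> u \<le> i \<and> i < \<phi> v} = cut_edges V {v \<in> V. \<phi> v \<le> i} \<inter> E"
    (is "?crossing = ?cut")
  proof (intro equalityI subsetI)
    fix e assume "e \<in> ?crossing"
    then obtain u v where e: "e \<in> E" "e = {u, v}" "\<phi> u \<le> i" "i < \<phi> v"
      by blast
    moreover from e assms have "u \<in> V" "v \<in> V"
      by (auto simp: possible_edges_def)
    ultimately show "e \<in> ?cut"
      by (force simp: cut_edges_def)
  next
    fix e assume "e \<in> ?cut"
    then show "e \<in> ?crossing"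
      by (fastforce simp: cut_edges_def)
  qed
  then show ?thesis
    by (simp add: theta_def)
qed

lemma layout_initial_half_in_bisections:
  assumes "\<phi> \<in> layouts (V, E)"
  shows "{v \<in> V. \<phi> v \<le> card V div 2} \<in> bisections V"
proof -
  have "bij_betw \<phi> V {1..card V}"
    using assms by (simp add: layouts_def)
  then have "bij_betw \<phi> {v \<in> V. \<phi> v \<le> card V div 2} {i \<in> {1..card V}. i \<le> card V div 2}"
    by (rule bij_betw_Collect) simp
  also have "{i \<in> {1..card V}. i \<le> card V div 2} = {1..card V div 2}"
    by auto
  finally show ?thesis
    by (auto simp: bisections_def dest: bij_betw_same_card)
qed

lemma EB_eq_card_bisection:
  assumes "E \<subseteq> possible_edges V" "\<phi> \<in> layouts (V, E)"
  shows "\<exists>S\<in>bisections V. EB (V, E) \<phi> = card (cut_edges V S \<inter> E)"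
  using layout_initial_half_in_bisections[OF assms(2)] theta_eq_card_cut_edges[OF assms(1)]
  by (auto simp: EB_def)

lemma
  assumes "finite (fst G)" "finite (snd G)"
  shows MINEB_attained: "\<exists>\<phi>\<in>layouts G. MINEB G = EB G \<phi>"
    and MAXEB_attained: "\<exists>\<phi>\<in>layouts G. MAXEB G = EB G \<phi>"
proof -
  note EB_values = finite_EB_layouts[OF assms(2)] EB_layouts_nonempty[OF assms(1)]
  show "\<exists>\<phi>\<in>layouts G. MINEB G = EB G \<phi>"
    using Min_in[OF EB_values] by (auto simp: MINEB_def)
  show "\<exists>\<phi>\<in>layouts G. MAXEB G = EB G \<phi>"
    using Max_in[OF EB_values] by (auto simp: MAXEB_def)
qed

lemma GAPEB_less_if_EB_concentrated:
  assumes "finite (fst G)" "finite (snd G)" and t: "0 < t" "t < 1"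
    and "\<And>\<phi>. \<phi> \<in> layouts G \<Longrightarrow> \<bar>real (EB G \<phi>) - q\<bar> < t * q"
  shows "GAPEB G < ereal ((1 + t) / (1 - t))"
proof -
  have MINEB_near: "\<bar>real (MINEB G) - q\<bar> < t * q"
    using MINEB_attained[of G] assms by auto
  have MAXEB_near: "\<bar>real (MAXEB G) - q\<bar> < t * q"
    using MAXEB_attained[of G] assms by auto
  have "0 < t * q"
    using MINEB_near by linarith
  then have "0 < (1 - t) * q"
    using t by (simp add: zero_less_mult_iff)
  moreover have MINEB_greater: "(1 - t) * q < real (MINEB G)"
    using MINEB_near by (simp add: algebra_simps abs_less_iff)
  ultimately have pos: "0 < real (MINEB G)"
    by linarith
  have "real (MAXEB G) < (1 + t) * q"
    using MAXEB_near by (simp add: algebra_simps abs_less_iff)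
  then have "(1 - t) * real (MAXEB G) < (1 - t) * ((1 + t) * q)"
    using t by simp
  also have "\<dots> = (1 + t) * ((1 - t) * q)"
    by simp
  also have "\<dots> < (1 + t) * real (MINEB G)"
    using MINEB_greater t by simp
  finally have "real (MAXEB G) / real (MINEB G) < (1 + t) / (1 - t)"
    using pos t by (simp add: field_simps)
  then show ?thesis
    using pos by (simp add: GAPEB_def)
qed

lemma map_pmf_card_Pi_pmf_bernoulli:
  assumes "finite A" "C \<subseteq> A" "p \<in> {0..1}"
  shows "map_pmf (\<lambda>b. card {x \<in> C. b x}) (Pi_pmf A False (\<lambda>_. bernoulli_pmf p)) =
    binomial_pmf (card C) p"
proof -
  have "binomial_pmf (card C) p =
      map_pmf (\<lambda>b. card {x \<in> C. b x}) (Pi_pmf C False (\<lambda>_. bernoulli_pmf p))"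
    using assms by (intro binomial_pmf_altdef') (auto intro: finite_subset)
  also have "\<dots> = map_pmf (\<lambda>b. card {x \<in> C. b x}) (Pi_pmf A False (\<lambda>_. bernoulli_pmf p))"
    unfolding Pi_pmf_subset[OF assms(1,2)] map_pmf_comp
    by (intro map_pmf_cong refl arg_cong[of _ _ card]) auto
  finally show ?thesis ..
qed

lemma prob_binomial_relative_deviation_le:
  fixes p t :: real
  assumes "p \<in> {0..1}" "0 \<le> t"
  shows "measure_pmf.prob (binomial_pmf m p) {k. \<bar>real k - m * p\<bar> \<ge> t * (m * p)}
    \<le> 2 * exp (- 2 * real m * (t * p)\<^sup>2)"
proof (cases "m = 0")
  case True
  then show ?thesis
    by (simp add: order.trans[OF measure_pmf.prob_le_1])
next
  case False
  have "measure_pmf.prob (binomial_pmf m p) {k. \<bar>real k - m * p\<bar> \<ge> t * (m * p)}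
      \<le> 2 * exp (- 2 * (t * (m * p))\<^sup>2 / m)"
    using assms False
    by (intro binomial_distribution.prob_abs_ge) (auto simp: binomial_distribution_def)
  also have "- 2 * (t * (m * p))\<^sup>2 / m = - 2 * real m * (t * p)\<^sup>2"
    using False by (simp add: power2_eq_square)
  finally show ?thesis .
qed

lemma map_pmf_card_Int_edges_Gnp:
  assumes "C \<subseteq> possible_edges {1..n}" "p \<in> {0..1}"
  shows "map_pmf (\<lambda>G. card (C \<inter> snd G)) (Gnp n p) = binomial_pmf (card C) p"
proof -
  have "map_pmf (\<lambda>G. card (C \<inter> snd G)) (Gnp n p) =
      map_pmf (\<lambda>b. card {e \<in> C. b e})
        (Pi_pmf (possible_edges {1..n}) False (\<lambda>_. bernoulli_pmf p))"
    unfolding Gnp_def map_pmf_comp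
    using assms(1) by (intro map_pmf_cong refl arg_cong[of _ _ card]) auto
  also have "\<dots> = binomial_pmf (card C) p"
    using assms by (intro map_pmf_card_Pi_pmf_bernoulli) (auto intro: finite_possible_edges)
  finally show ?thesis .
qed

lemma prob_Gnp_bisection_deviation_le:
  fixes n :: nat and p t :: real
  assumes p: "p \<in> {0..1}" and "0 \<le> t"
  defines "m \<equiv> real (bisection_cut_size n)"
  shows "measure_pmf.prob (Gnp n p)
      {G. \<exists>S\<in>bisections {1..n}. \<bar>real (card (cut_edges {1..n} S \<inter> snd G)) - m * p\<bar> \<ge> t * (m * p)}
    \<le> 2 ^ n * (2 * exp (- 2 * m * (t * p)\<^sup>2))"
proof -
  define deviating where "deviating S =
    {G :: nat graph. \<bar>real (card (cut_edges {1..n} S \<inter> snd G)) - m * p\<bar> \<ge> t * (m * p)}" for S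
  have prob_deviating: "measure_pmf.prob (Gnp n p) (deviating S) \<le> 2 * exp (- 2 * m * (t * p)\<^sup>2)"
    if S: "S \<in> bisections {1..n}" for S
  proof -
    have "cut_edges {1..n} S \<subseteq> possible_edges {1..n}"
      using S by (intro cut_edges_subset_possible_edges) (simp add: bisections_def)
    from map_pmf_card_Int_edges_Gnp[OF this p]
    have binomial: "map_pmf (\<lambda>G. card (cut_edges {1..n} S \<inter> snd G)) (Gnp n p) =
        binomial_pmf (bisection_cut_size n) p"
      using card_cut_edges_bisection[OF _ S] by simp
    have "measure_pmf.prob (Gnp n p) (deviating S) =
        measure_pmf.prob (binomial_pmf (bisection_cut_size n) p)
          {k. \<bar>real k - m * p\<bar> \<ge> t * (m * p)}"
      by (simp add: deviating_def vimage_def flip: binomial)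
    then show ?thesis
      using prob_binomial_relative_deviation_le[OF p \<open>0 \<le> t\<close>] by (simp add: m_def)
  qed
  have "measure_pmf.prob (Gnp n p) (\<Union>S\<in>bisections {1..n}. deviating S)
      \<le> (\<Sum>S\<in>bisections {1..n}. measure_pmf.prob (Gnp n p) (deviating S))"
    by (intro measure_pmf.finite_measure_subadditive_finite) (auto simp: finite_bisections)
  also have "\<dots> \<le> real (card (bisections {1..n})) * (2 * exp (- 2 * m * (t * p)\<^sup>2))"
    using prob_deviating by (intro sum_bounded_above) auto
  also have "\<dots> \<le> 2 ^ n * (2 * exp (- 2 * m * (t * p)\<^sup>2))"
    using of_nat_mono[OF card_bisections_le[of "{1..n}"], where 'a = real]
    by (intro mult_right_mono) simp_all
  finally show ?thesis
    by (simp add: deviating_def Collect_bex_eq)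
qed

lemma prob_Gnp_GAPEB_less_ge:
  fixes p t :: real
  assumes "p \<in> {0..1}" "0 < t" "t < 1"
  shows "measure_pmf.prob (Gnp n p) {G. GAPEB G < ereal ((1 + t) / (1 - t))}
    \<ge> 1 - 2 ^ n * (2 * exp (- 2 * real (bisection_cut_size n) * (t * p)\<^sup>2))"
proof -
  define q where "q = real (bisection_cut_size n) * p"
  define deviation where "deviation = {G :: nat graph. \<exists>S\<in>bisections {1..n}.
    \<bar>real (card (cut_edges {1..n} S \<inter> snd G)) - q\<bar> \<ge> t * q}"
  have "G \<in> {G. GAPEB G < ereal ((1 + t) / (1 - t))}"
    if G: "G \<in> (- deviation) \<inter> set_pmf (Gnp n p)" for G
  proof -
    obtain E where E: "G = ({1..n}, E)" "E \<subseteq> possible_edges {1..n}"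
      using G by (auto simp: Gnp_def)
    have "\<bar>real (EB G \<phi>) - q\<bar> < t * q" if "\<phi> \<in> layouts G" for \<phi>
      using EB_eq_card_bisection[of E "{1..n}" \<phi>] that E G by (auto simp: deviation_def not_le)
    then show ?thesis
      using GAPEB_less_if_EB_concentrated[of G t q] E assms
      by (auto intro: finite_subset[OF _ finite_possible_edges])
  qed
  then have "measure_pmf.prob (Gnp n p) (- deviation)
      \<le> measure_pmf.prob (Gnp n p) {G. GAPEB G < ereal ((1 + t) / (1 - t))}"
    by (subst measure_Int_set_pmf[symmetric], intro measure_pmf.finite_measure_mono) auto
  moreover have "measure_pmf.prob (Gnp n p) (- deviation) =
      1 - measure_pmf.prob (Gnp n p) deviation"
    using measure_pmf.prob_compl[of deviation] by (simp add: Compl_eq_Diff_UNIV)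
  moreover have "measure_pmf.prob (Gnp n p) deviation
      \<le> 2 ^ n * (2 * exp (- 2 * real (bisection_cut_size n) * (t * p)\<^sup>2))"
    using prob_Gnp_bisection_deviation_le assms unfolding deviation_def q_def by simp
  ultimately show ?thesis
    by linarith
qed

lemma bisection_cut_size_bigomega: "(\<lambda>n. real (bisection_cut_size n)) \<in> \<Omega>(\<lambda>n. real n ^ 2)"
proof -
  have "\<forall>\<^sub>F n in sequentially. norm (real (n div 2)) \<ge> 1/3 * norm (real n)"
    using eventually_ge_at_top[of 2]
  proof eventually_elim
    case (elim n)
    then have "n \<le> 3 * (n div 2)"
      by presburger
    then show ?case
      by simp
  qed
  then have "(\<lambda>n. real (n div 2)) \<in> \<Omega>(\<lambda>n. real n)"
    by (rule landau_omega.bigI[rotated]) simp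
  moreover have "(\<lambda>n. real (n - n div 2)) \<in> \<Omega>(\<lambda>n. real n)"
    by (rule landau_omega.bigI[of "1/2"]) (auto intro!: always_eventually)
  ultimately have "(\<lambda>n. real (n div 2) * real (n - n div 2)) \<in> \<Omega>(\<lambda>n. real n * real n)"
    by (rule landau_omega.big_mult)
  then show ?thesis
    by (simp add: bisection_cut_size_def power2_eq_square del: of_nat_diff)
qed

lemma power_mult_exp_uminus_tendsto_0:
  fixes f :: "nat \<Rightarrow> real"
  assumes "f \<in> \<omega>(\<lambda>n. real n)" "\<And>n. 0 \<le> f n" "0 \<le> b"
  shows "(\<lambda>n. b ^ n * exp (- f n)) \<longlonglongrightarrow> 0"
proof (rule tendsto_sandwich[of "\<lambda>_. 0" _ _ "\<lambda>n. exp (- real n)"])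
  show "\<forall>\<^sub>F n in sequentially. b ^ n * exp (- f n) \<le> exp (- real n)"
    using smallomegaD[OF assms(1), of "b + 1"]
  proof eventually_elim
    case (elim n)
    have "b \<le> exp b"
      using exp_ge_add_one_self[of b] by linarith
    then have "b ^ n \<le> exp b ^ n"
      using assms(3) by (rule power_mono)
    then have "b ^ n * exp (- f n) \<le> exp b ^ n * exp (- f n)"
      by (intro mult_right_mono) auto
    also have "\<dots> = exp (real n * b - f n)"
      by (simp add: exp_of_nat_mult exp_diff exp_minus divide_inverse)
    also have "\<dots> \<le> exp (- real n)"
      using elim assms(2)[of n] by (simp add: algebra_simps)
    finally show ?case .
  qed
  show "(\<lambda>n. exp (- real n)) \<longlonglongrightarrow> 0"
    by real_asymp
qed (use assms(3) in auto)

lemma bisection_union_bound_tendsto_0: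
  fixes c t :: real and p :: "nat \<Rightarrow> real"
  assumes "c < 1/2" "p \<in> \<Omega>(\<lambda>n. real n powr (-c))" "t \<noteq> 0"
  shows "(\<lambda>n. 2 ^ n * (2 * exp (- 2 * real (bisection_cut_size n) * (t * p n)\<^sup>2))) \<longlonglongrightarrow> 0"
proof -
  have "(\<lambda>n. (2 * t\<^sup>2) * (real (bisection_cut_size n) * p n ^ 2))
      \<in> \<Omega>(\<lambda>n. real n ^ 2 * (real n powr (-c)) ^ 2)"
    using assms(3)
      landau_omega.big_mult[OF bisection_cut_size_bigomega landau_omega.big_power[OF assms(2)]]
    by simp
  also have "(\<lambda>n. real n ^ 2 * (real n powr (-c)) ^ 2) \<in> \<omega>(\<lambda>n. real n)"
    using assms(1) by real_asymp
  finally have "(\<lambda>n. 2 ^ n * exp (- ((2 * t\<^sup>2) * (real (bisection_cut_size n) * p n ^ 2))))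
      \<longlonglongrightarrow> 0"
    by (rule power_mult_exp_uminus_tendsto_0) auto
  from tendsto_mult_left[OF this, of 2] show ?thesis
    by (simp add: power_mult_distrib mult_ac)
qed

theorem theorem3:
  fixes c :: real and p :: "nat \<Rightarrow> real"
  assumes "0 \<le> c" and "c < 1/2"
    and "\<And>n. n \<ge> 1 \<Longrightarrow> p n \<in> {0..1}"
    and "p \<in> \<Omega>(\<lambda>n. real n powr (-c))"
  shows "\<forall>\<epsilon>>0. \<forall>\<delta>>0. \<exists>N. \<forall>n\<ge>N.
    measure_pmf.prob (Gnp n (p n)) {G. GAPEB G < ereal (1 + \<delta>)} > 1 - \<epsilon>"
proof (intro allI impI)
  fix \<epsilon> \<delta> :: real assume "\<epsilon> > 0" "\<delta> > 0"
  define t where "t = \<delta> / (2 + \<delta>)"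
  have t: "0 < t" "t < 1" "(1 + t) / (1 - t) = 1 + \<delta>"
    using \<open>\<delta> > 0\<close> by (auto simp: t_def field_simps)
  have "(\<lambda>n. 2 ^ n * (2 * exp (- 2 * real (bisection_cut_size n) * (t * p n)\<^sup>2))) \<longlonglongrightarrow> 0"
    using bisection_union_bound_tendsto_0 assms(2,4) t(1) by simp
  then have "\<forall>\<^sub>F n in sequentially.
      2 ^ n * (2 * exp (- 2 * real (bisection_cut_size n) * (t * p n)\<^sup>2)) < \<epsilon>"
    using \<open>\<epsilon> > 0\<close> by (rule order_tendstoD)
  then have "\<forall>\<^sub>F n in sequentially.
      measure_pmf.prob (Gnp n (p n)) {G. GAPEB G < ereal (1 + \<delta>)} > 1 - \<epsilon>"
    using eventually_ge_at_top[of 1]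
  proof eventually_elim
    case (elim n)
    then show ?case
      using prob_Gnp_GAPEB_less_ge[OF assms(3) t(1,2), of n n] unfolding t(3) by linarith
  qed
  then show "\<exists>N. \<forall>n\<ge>N. measure_pmf.prob (Gnp n (p n)) {G. GAPEB G < ereal (1 + \<delta>)} > 1 - \<epsilon>"
    by (simp add: eventually_sequentially)
qed

end
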